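(* Let $F$ be R. Thompson's group $F$. For every automorphism $\phi: F \to F$, the Reidemeister number $R(\phi)$ is infinite, i.e. $\phi$ has infinitely many twisted conjugacy classes.
   Context: R. Thompson's group $F$ is the group, under composition, of all homeomorphisms $\alpha: \mathbf{R} \to \mathbf{R}$ such that $\alpha$: (1) is piecewise-linear with finitely many breaks in slope; (2) is orientation-preserving; (3) has all slopes of affine portions of its graph in the set $\{2^k \mid k \in \mathbf{Z}\}$; (4) has all breaks in slope occurring over the dyadic rationals $\mathbf{Z}[1/2]$; (5) maps $\mathbf{Z}[1/2]$ into $\mathbf{Z}[1/2]$; (6) has first and last affine components equal to pure translations by (potentially distinct) integers. For an automorphism $\phi: G \to G$ of a group $G$, the twisted conjugacy classes (also called Reidemeister classes or $\phi$-conjugacy classes) are the equivalence classes of the relation $x \sim g x \phi(g^{-1})$, $g \in G$, on $G$. The Reidemeister number $R(\phi)$ is the number of these classes. *)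

theory Defs
  imports "HOL-Analysis.Analysis" "HOL-Algebra.Group" "HOL-Library.Extended_Nat"
begin

definition dyadic_rationals :: "real set" where
  "dyadic_rationals = {of_int a / 2 ^ n | (a :: int) (n :: nat). True}"

definition affine_with_slope_on :: "real \<Rightarrow> real set \<Rightarrow> (real \<Rightarrow> real) \<Rightarrow> bool" where
  "affine_with_slope_on m S f \<longleftrightarrow> (\<exists>b. \<forall>y\<in>S. f y = m * y + b)"

definition breaks :: "(real \<Rightarrow> real) \<Rightarrow> real set" where
  "breaks f = {x. \<not> (\<exists>u v m. u < x \<and> x < v \<and> affine_with_slope_on m {u<..<v} f)}"

definition slopes :: "(real \<Rightarrow> real) \<Rightarrow> real set" where
  "slopes f = {m. \<exists>u v. u < v \<and> affine_with_slope_on m {u<..<v} f}"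

text \<open>
  A continuous function with finitely many breaks is affine on each component of the
  complement of its breaks, so finiteness of the set of breaks is what makes a homeomorphism
  piecewise linear. Agreeing near \<open>- \<infinity>\<close> with an integer translation then amounts to the first
  affine component being that translation; likewise for the last component and \<open>\<infinity>\<close>.
\<close>

definition thompson_F_carrier :: "(real \<Rightarrow> real) set" where
  "thompson_F_carrier = {f.
     (\<exists>g. homeomorphism UNIV UNIV f g) \<and>
     finite (breaks f) \<and>
     strict_mono f \<and>
     slopes f \<subseteq> {2 powi k | k :: int. True} \<and>
     breaks f \<subseteq> dyadic_rationals \<and>
     f ` dyadic_rationals \<subseteq> dyadic_rationals \<and>
     (\<exists>i :: int. eventually (\<lambda>x. f x = x + of_int i) at_bot) \<and>
     (\<exists>j :: int. eventually (\<lambda>x. f x = x + of_int j) at_top)}"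

definition thompson_F :: "(real \<Rightarrow> real) monoid" where
  "thompson_F = \<lparr>carrier = thompson_F_carrier, mult = (\<lambda>f g. f \<circ> g), one = id\<rparr>"

definition twisted_conj :: "('a, 'b) monoid_scheme \<Rightarrow> ('a \<Rightarrow> 'a) \<Rightarrow> ('a \<times> 'a) set" where
  "twisted_conj G \<phi> = {(x, y). x \<in> carrier G \<and> y \<in> carrier G \<and>
     (\<exists>g\<in>carrier G. y = g \<otimes>\<^bsub>G\<^esub> x \<otimes>\<^bsub>G\<^esub> \<phi> (inv\<^bsub>G\<^esub> g))}"

definition reidemeister_number :: "('a, 'b) monoid_scheme \<Rightarrow> ('a \<Rightarrow> 'a) \<Rightarrow> enat" where
  "reidemeister_number G \<phi> =
     (let C = carrier G // twisted_conj G \<phi> in if finite C then enat (card C) else \<infinity>)"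

end

theory Submission imports Defs begin

text \<open>
  Near \<open>- \<infinity>\<close> an element \<open>f\<close> of \<open>F\<close> is translation by an integer \<open>i f\<close> (\<open>shift_bot\<close>), near
  \<open>\<infinity>\<close> by an integer \<open>j f\<close> (\<open>shift_top\<close>), and \<open>i\<close>, \<open>j\<close> are homomorphisms to the integers. The
  theorem holds because every automorphism \<open>\<phi>\<close> fixes the homomorphism \<open>w = j - i\<close>. Once this is
  known, \<open>w (g x \<phi>(g\<^sup>-\<^sup>1)) = w x\<close>, so \<open>w\<close> is constant on twisted conjugacy classes; as \<open>w\<close>
  takes infinitely many values, there are infinitely many classes.

  To see that \<open>w\<close> is fixed, the quadrant \<open>i f \<le> 0 \<le> j f\<close> is described in terms of the group
  operation alone. Say that \<open>f\<close> displaces commutators if for some \<open>k \<noteq> 1\<close> and every commutator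
  \<open>c\<close> the conjugates \<open>f\<^sup>n c f\<^sup>-\<^sup>n\<close> commute with \<open>k\<close> for all large \<open>n\<close>. Commutators have compact
  support. If \<open>i f > 0\<close>, the powers of \<open>f\<close> push every compact set out of a neighbourhood of
  \<open>- \<infinity>\<close>, so a \<open>k\<close> supported there is a witness; likewise at \<open>\<infinity>\<close> if \<open>j f < 0\<close>. In the
  quadrant, in contrast, \<open>f\<close> maps large intervals \<open>[-A, A]\<close> onto supersets of themselves, and
  there is a commutator that agrees on \<open>[-A, A]\<close> with any prescribed element. If \<open>k\<close> does not
  commute with \<open>f\<close>, a commutator equal to \<open>f\<close> on \<open>[-A, A]\<close> has all its conjugates under
  powers of \<open>f\<close> equal to \<open>f\<close> there and refutes \<open>k\<close>. If \<open>k\<close> commutes with \<open>f\<close>, a commutator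
  commuting with \<open>k\<close> after conjugation by \<open>f\<^sup>n\<close> commutes with it before, and one that does not
  commute with \<open>k\<close> exists because \<open>F\<close> has trivial centre. Hence the quadrant is exactly the set of
  elements that do not displace commutators (\<open>displaces_commutators_iff\<close>).

  An automorphism therefore preserves the quadrant, in both directions. It sends the two generators
  of the monoid of nonnegative integer pairs to nonzero elements of this monoid, so it cannot
  decrease \<open>w\<close> on the quadrant; nor can its inverse, and so \<open>w\<close> is preserved on the quadrant and
  then everywhere (\<open>quadrant_weight_invariant\<close>).
\<close>

section \<open>Dyadic rationals\<close>

lemma dyadic_of_int: "of_int a \<in> dyadic_rationals"
  unfolding dyadic_rationals_def by (auto intro!: exI[of _ a] exI[of _ "0::nat"])

lemma dyadic_add:
  assumes "x \<in> dyadic_rationals" "y \<in> dyadic_rationals"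
  shows "x + y \<in> dyadic_rationals"
proof -
  obtain a b :: int and m n :: nat where "x = of_int a / 2 ^ m" "y = of_int b / 2 ^ n"
    using assms unfolding dyadic_rationals_def by blast
  then have "x + y = of_int (a * 2 ^ n + b * 2 ^ m) / 2 ^ (m + n)"
    by (simp add: add_divide_distrib power_add)
  then show ?thesis unfolding dyadic_rationals_def by blast
qed

lemma dyadic_mult:
  assumes "x \<in> dyadic_rationals" "y \<in> dyadic_rationals"
  shows "x * y \<in> dyadic_rationals"
proof -
  obtain a b :: int and m n :: nat where "x = of_int a / 2 ^ m" "y = of_int b / 2 ^ n"
    using assms unfolding dyadic_rationals_def by blast
  then have "x * y = of_int (a * b) / 2 ^ (m + n)"
    by (simp add: power_add)
  then show ?thesis unfolding dyadic_rationals_def by blast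
qed

lemma dyadic_diff:
  assumes "x \<in> dyadic_rationals" "y \<in> dyadic_rationals"
  shows "x - y \<in> dyadic_rationals"
  using dyadic_add[OF assms(1) dyadic_mult[OF dyadic_of_int[of "-1"] assms(2)]] by simp

lemma dyadic_powi: "(2::real) powi k \<in> dyadic_rationals"
proof (cases "k \<ge> 0")
  case True
  then have "(2::real) powi k = of_int (2 ^ nat k)" by (simp add: power_int_def)
  then show ?thesis by (metis dyadic_of_int)
next
  case False
  then have "(2::real) powi k = of_int 1 / 2 ^ nat (-k)"
    by (simp add: power_int_def inverse_eq_divide power_divide)
  then show ?thesis unfolding dyadic_rationals_def by blast
qed

lemma dyadic_dense:
  assumes "u < v"
  obtains d where "d \<in> dyadic_rationals" "u < d" "d < v"
proof -
  obtain n :: nat where n: "1 / (v - u) < 2 ^ n"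
    using real_arch_pow[of 2 "1 / (v - u)"] by auto
  let ?a = "\<lfloor>u * 2 ^ n\<rfloor> + 1"
  have "u * 2 ^ n < of_int ?a" by linarith
  moreover have "1 < (v - u) * 2 ^ n" using n assms by (simp add: field_simps)
  then have "of_int ?a < v * 2 ^ n" using of_int_floor_le[of "u * 2 ^ n"]
    by (simp add: algebra_simps) linarith
  ultimately have "u < of_int ?a / 2 ^ n" "of_int ?a / 2 ^ n < v"
    by (simp_all add: field_simps)
  moreover have "of_int ?a / 2 ^ n \<in> dyadic_rationals"
    unfolding dyadic_rationals_def by blast
  ultimately show ?thesis using that by blast
qed

section \<open>Thompson's group as a group\<close>

text \<open>
  Being affine near a point is stated with the neighbourhood filter because this form composes
  directly with continuous maps. Away from a finite dyadic set it replaces the two conditions on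
  breaks and slopes.
\<close>

definition dyadic_affine_at :: "(real \<Rightarrow> real) \<Rightarrow> real \<Rightarrow> bool" where
  "dyadic_affine_at f x \<longleftrightarrow> (\<exists>k b. \<forall>\<^sub>F y in nhds x. f y = 2 powi k * y + b)"

lemma eventually_nhds_real_interval:
  fixes x :: real
  shows "eventually P (nhds x) \<longleftrightarrow> (\<exists>u v. u < x \<and> x < v \<and> (\<forall>y\<in>{u<..<v}. P y))"
proof
  assume "eventually P (nhds x)"
  then obtain e where e: "e > 0" "\<And>y. dist y x < e \<Longrightarrow> P y"
    by (auto simp: eventually_nhds_metric)
  then have "\<forall>y\<in>{x - e<..<x + e}. P y" by (auto simp: dist_real_def)
  with e(1) show "\<exists>u v. u < x \<and> x < v \<and> (\<forall>y\<in>{u<..<v}. P y)"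
    by (intro exI[of _ "x - e"] exI[of _ "x + e"]) auto
next
  assume "\<exists>u v. u < x \<and> x < v \<and> (\<forall>y\<in>{u<..<v}. P y)"
  then obtain u v where "u < x" "x < v" "\<forall>y\<in>{u<..<v}. P y" by blast
  then show "eventually P (nhds x)"
    by (auto simp: eventually_nhds intro!: exI[of _ "{u<..<v}"])
qed

lemma slope_unique:
  fixes m m' b b' x :: real
  assumes "\<forall>\<^sub>F y in nhds x. f y = m * y + b" "\<forall>\<^sub>F y in nhds x. f y = m' * y + b'"
  shows "m = m'"
proof -
  have "\<forall>\<^sub>F y in nhds x. m * y + b = m' * y + b'"
    using assms by eventually_elim simp
  then obtain u v where uv: "u < x" "x < v" "\<forall>y\<in>{u<..<v}. m * y + b = m' * y + b'"
    unfolding eventually_nhds_real_interval by blast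
  define y where "y = (u + x) / 2"
  have "y \<in> {u<..<v}" "y \<noteq> x" using uv by (auto simp: y_def)
  with uv have "m * x + b = m' * x + b'" "m * y + b = m' * y + b'" by auto
  then have "(m - m') * (x - y) = 0" by (simp add: algebra_simps)
  with \<open>y \<noteq> x\<close> show ?thesis by simp
qed

lemma affine_at_imp_slopes:
  assumes "\<forall>\<^sub>F y in nhds x. f y = m * y + b"
  shows "m \<in> slopes f"
  using assms unfolding eventually_nhds_real_interval slopes_def affine_with_slope_on_def
  by fastforce

lemma dyadic_affine_outside_breaks:
  assumes "f \<in> thompson_F_carrier" "x \<notin> breaks f"
  shows "dyadic_affine_at f x"
proof -
  obtain u v m b where *: "u < x" "x < v" "\<forall>y\<in>{u<..<v}. f y = m * y + b"
    using assms(2) unfolding breaks_def affine_with_slope_on_def by auto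
  then have ev: "\<forall>\<^sub>F y in nhds x. f y = m * y + b"
    unfolding eventually_nhds_real_interval by blast
  then have "m \<in> slopes f" by (rule affine_at_imp_slopes)
  then obtain k where "m = 2 powi k"
    using assms(1) unfolding thompson_F_carrier_def by auto
  with ev show ?thesis unfolding dyadic_affine_at_def by blast
qed

text \<open>
  Every slope of \<open>f\<close> is attained on an interval, which contains a point outside the finite set
  \<open>B\<close>; there the slope agrees with the local one, a power of two.
\<close>

lemma thompson_F_carrierI:
  assumes "homeomorphism UNIV UNIV f g" and "strict_mono f"
    and "finite B" "B \<subseteq> dyadic_rationals" and aff: "\<And>x. x \<notin> B \<Longrightarrow> dyadic_affine_at f x"
    and "f ` dyadic_rationals \<subseteq> dyadic_rationals"
    and "\<forall>\<^sub>F x in at_bot. f x = x + of_int i" "\<forall>\<^sub>F x in at_top. f x = x + of_int j"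
  shows "f \<in> thompson_F_carrier"
proof -
  have br: "breaks f \<subseteq> B"
  proof
    fix x assume x: "x \<in> breaks f"
    show "x \<in> B"
    proof (rule ccontr)
      assume "x \<notin> B"
      with aff obtain k b where "\<forall>\<^sub>F y in nhds x. f y = 2 powi k * y + b"
        unfolding dyadic_affine_at_def by blast
      then have "x \<notin> breaks f"
        unfolding eventually_nhds_real_interval breaks_def affine_with_slope_on_def by blast
      with x show False by simp
    qed
  qed
  have "slopes f \<subseteq> {2 powi k | k :: int. True}"
  proof
    fix m assume "m \<in> slopes f"
    then obtain u v b where *: "u < v" "\<forall>y\<in>{u<..<v}. f y = m * y + b"
      unfolding slopes_def affine_with_slope_on_def by blast
    have "infinite ({u<..<v} - B)" using * assms(3) by (simp add: infinite_Ioo)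
    then obtain x where x: "x \<in> {u<..<v}" "x \<notin> B"
      by (metis Diff_iff ex_in_conv infinite_imp_nonempty)
    have "\<forall>\<^sub>F y in nhds x. f y = m * y + b"
      using x * unfolding eventually_nhds_real_interval by auto
    moreover obtain k c where "\<forall>\<^sub>F y in nhds x. f y = 2 powi k * y + c"
      using aff[OF x(2)] unfolding dyadic_affine_at_def by blast
    ultimately have "m = 2 powi k" by (rule slope_unique)
    then show "m \<in> {2 powi k | k :: int. True}" by blast
  qed
  then show ?thesis
    unfolding thompson_F_carrier_def using assms br by (auto intro: finite_subset)
qed

lemma thompson_F_dest:
  assumes "f \<in> thompson_F_carrier"
  shows "strict_mono f" "bij f" "continuous_on UNIV f" "continuous_on UNIV (inv_into UNIV f)"
    "homeomorphism UNIV UNIV f (inv_into UNIV f)"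
    "x \<in> dyadic_rationals \<Longrightarrow> f x \<in> dyadic_rationals"
proof -
  show "strict_mono f" "x \<in> dyadic_rationals \<Longrightarrow> f x \<in> dyadic_rationals"
    using assms unfolding thompson_F_carrier_def by auto
  obtain g where g: "homeomorphism UNIV UNIV f g"
    using assms unfolding thompson_F_carrier_def by auto
  then have fg: "\<And>x. f (g x) = x" "\<And>x. g (f x) = x"
    unfolding homeomorphism_def by auto
  then show "bij f" by (metis bijI')
  have "inv_into UNIV f = g" using fg by (simp add: inv_equality ext)
  with g show "homeomorphism UNIV UNIV f (inv_into UNIV f)" by simp
  then show "continuous_on UNIV f" "continuous_on UNIV (inv_into UNIV f)"
    unfolding homeomorphism_def by auto
qed

lemma thompson_F_inv_apply:
  assumes "f \<in> thompson_F_carrier"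
  shows "f (inv_into UNIV f x) = x" "inv_into UNIV f (f x) = x"
  using thompson_F_dest(2)[OF assms]
  by (simp_all add: bij_is_surj surj_f_inv_f bij_is_inj)

lemma thompson_F_less_iff:
  assumes "f \<in> thompson_F_carrier"
  shows "f x < f y \<longleftrightarrow> x < y" "f x \<le> f y \<longleftrightarrow> x \<le> y" "f x = f y \<longleftrightarrow> x = y"
  using thompson_F_dest(1)[OF assms]
  by (simp_all add: strict_mono_less strict_mono_less_eq strict_mono_eq)

lemma dyadic_affine_at_inverse:
  assumes f: "f \<in> thompson_F_carrier" and aff: "dyadic_affine_at f x"
  shows "dyadic_affine_at (inv_into UNIV f) (f x)"
proof -
  let ?g = "inv_into UNIV f"
  obtain k b where kb: "\<forall>\<^sub>F y in nhds x. f y = 2 powi k * y + b"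
    using aff unfolding dyadic_affine_at_def by blast
  have "filterlim ?g (nhds (?g (f x))) (nhds (f x))"
    using thompson_F_dest(4)[OF f] by (simp add: continuous_on_eq_continuous_at isCont_def
        tendsto_at_iff_tendsto_nhds)
  then have "filterlim ?g (nhds x) (nhds (f x))" by (simp add: thompson_F_inv_apply[OF f])
  from eventually_compose_filterlim[OF kb this]
  have "\<forall>\<^sub>F y in nhds (f x). ?g y = 2 powi (- k) * y + - (2 powi (- k) * b)"
    by eventually_elim
      (simp add: thompson_F_inv_apply[OF f] power_int_minus field_simps)
  then show ?thesis unfolding dyadic_affine_at_def by blast
qed

lemma dyadic_affine_at_compose:
  assumes g: "g \<in> thompson_F_carrier"
    and affg: "dyadic_affine_at g x" and afff: "dyadic_affine_at f (g x)"
  shows "dyadic_affine_at (f \<circ> g) x"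
proof -
  obtain k b where kb: "\<forall>\<^sub>F y in nhds x. g y = 2 powi k * y + b"
    using affg unfolding dyadic_affine_at_def by blast
  obtain l c where lc: "\<forall>\<^sub>F y in nhds (g x). f y = 2 powi l * y + c"
    using afff unfolding dyadic_affine_at_def by blast
  have "filterlim g (nhds (g x)) (nhds x)"
    using thompson_F_dest(3)[OF g] by (simp add: continuous_on_eq_continuous_at isCont_def
        tendsto_at_iff_tendsto_nhds)
  from eventually_compose_filterlim[OF lc this] kb
  have "\<forall>\<^sub>F y in nhds x. (f \<circ> g) y = 2 powi (l + k) * y + (2 powi l * b + c)"
    by eventually_elim (simp add: power_int_add algebra_simps)
  then show ?thesis unfolding dyadic_affine_at_def by blast
qed

text \<open>
  Membership in \<open>F\<close> only asks that dyadic rationals be mapped to dyadic rationals. The converse,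
  needed for inverses, holds because an affine piece contains a dyadic \<open>d\<close> by density and
  \<open>x = d + (f x - f d) / m\<close> with \<open>m\<close> the slope, a power of two.
\<close>

lemma thompson_F_dyadic_iff:
  assumes f: "f \<in> thompson_F_carrier"
  shows "f x \<in> dyadic_rationals \<longleftrightarrow> x \<in> dyadic_rationals"
proof
  assume fx: "f x \<in> dyadic_rationals"
  show "x \<in> dyadic_rationals"
  proof (cases "x \<in> breaks f")
    case True
    then show ?thesis using f unfolding thompson_F_carrier_def by auto
  next
    case False
    then obtain k b where "\<forall>\<^sub>F y in nhds x. f y = 2 powi k * y + b"
      using dyadic_affine_outside_breaks[OF f] unfolding dyadic_affine_at_def by blast
    then obtain u v where uv: "u < x" "x < v" "\<forall>y\<in>{u<..<v}. f y = 2 powi k * y + b"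
      unfolding eventually_nhds_real_interval by blast
    then obtain d where d: "d \<in> dyadic_rationals" "u < d" "d < v"
      using dyadic_dense by (metis less_trans)
    have "x = d + 2 powi (- k) * (f x - f d)"
      using uv d by (simp add: power_int_minus field_simps)
    then show ?thesis
      by (metis d(1) dyadic_add dyadic_diff dyadic_mult dyadic_powi fx thompson_F_dest(6)[OF f])
  qed
qed (rule thompson_F_dest(6)[OF f])

lemma thompson_F_ends:
  assumes "f \<in> thompson_F_carrier"
  obtains i j :: int where "\<forall>\<^sub>F x in at_bot. f x = x + of_int i"
    "\<forall>\<^sub>F x in at_top. f x = x + of_int j"
  using assms unfolding thompson_F_carrier_def by auto

lemma translation_at_bot: "filterlim (\<lambda>x. x + c :: real) at_bot at_bot"
  unfolding filterlim_at_bot eventually_at_bot_linorder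
  by (metis add.commute le_diff_eq)

lemma translation_at_top: "filterlim (\<lambda>x. x + c :: real) at_top at_top"
  unfolding filterlim_at_top eventually_at_top_linorder
  by (metis add.commute diff_le_eq)

lemma at_bot_translation_compose:
  fixes a b :: real
  assumes "\<forall>\<^sub>F x in at_bot. f x = x + a" "\<forall>\<^sub>F x in at_bot. g x = x + b"
  shows "\<forall>\<^sub>F x in at_bot. (f \<circ> g) x = x + (a + b)"
  using eventually_compose_filterlim[OF assms(1) translation_at_bot[of b]] assms(2)
  by eventually_elim simp

lemma at_top_translation_compose:
  fixes a b :: real
  assumes "\<forall>\<^sub>F x in at_top. f x = x + a" "\<forall>\<^sub>F x in at_top. g x = x + b"
  shows "\<forall>\<^sub>F x in at_top. (f \<circ> g) x = x + (a + b)"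
  using eventually_compose_filterlim[OF assms(1) translation_at_top[of b]] assms(2)
  by eventually_elim simp

lemma thompson_F_compose:
  assumes f: "f \<in> thompson_F_carrier" and g: "g \<in> thompson_F_carrier"
  shows "f \<circ> g \<in> thompson_F_carrier"
proof -
  obtain i j :: int where fij: "\<forall>\<^sub>F x in at_bot. f x = x + of_int i"
    "\<forall>\<^sub>F x in at_top. f x = x + of_int j" using thompson_F_ends[OF f] .
  obtain k l :: int where gkl: "\<forall>\<^sub>F x in at_bot. g x = x + of_int k"
    "\<forall>\<^sub>F x in at_top. g x = x + of_int l" using thompson_F_ends[OF g] .
  have fb: "finite (breaks f)" "breaks f \<subseteq> dyadic_rationals" "finite (breaks g)"
    "breaks g \<subseteq> dyadic_rationals"
    using f g unfolding thompson_F_carrier_def by auto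
  show ?thesis
  proof (rule thompson_F_carrierI)
    show "homeomorphism UNIV UNIV (f \<circ> g) (inv_into UNIV g \<circ> inv_into UNIV f)"
      using homeomorphism_compose[OF thompson_F_dest(5)[OF g] thompson_F_dest(5)[OF f]] .
    show "strict_mono (f \<circ> g)"
      using thompson_F_less_iff[OF f] thompson_F_less_iff[OF g] by (simp add: strict_mono_def)
    show "finite (breaks g \<union> g -` breaks f)"
      using fb finite_vimageI[OF fb(1) bij_is_inj[OF thompson_F_dest(2)[OF g]]] by simp
    show "breaks g \<union> g -` breaks f \<subseteq> dyadic_rationals"
      using fb thompson_F_dyadic_iff[OF g] by auto
    show "dyadic_affine_at (f \<circ> g) x" if "x \<notin> breaks g \<union> g -` breaks f" for x
      using that dyadic_affine_at_compose[OF g] dyadic_affine_outside_breaks[OF f]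
        dyadic_affine_outside_breaks[OF g] by auto
    show "(f \<circ> g) ` dyadic_rationals \<subseteq> dyadic_rationals"
      using thompson_F_dest(6)[OF f] thompson_F_dest(6)[OF g] by auto
    show "\<forall>\<^sub>F x in at_bot. (f \<circ> g) x = x + of_int (i + k)"
      using at_bot_translation_compose[OF fij(1) gkl(1)] by simp
    show "\<forall>\<^sub>F x in at_top. (f \<circ> g) x = x + of_int (j + l)"
      using at_top_translation_compose[OF fij(2) gkl(2)] by simp
  qed
qed

lemma thompson_F_inverse:
  assumes f: "f \<in> thompson_F_carrier"
  shows "inv_into UNIV f \<in> thompson_F_carrier"
proof -
  let ?g = "inv_into UNIV f"
  obtain i j :: int where fij: "\<forall>\<^sub>F x in at_bot. f x = x + of_int i"
    "\<forall>\<^sub>F x in at_top. f x = x + of_int j" using thompson_F_ends[OF f] .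
  have fb: "finite (breaks f)" "breaks f \<subseteq> dyadic_rationals"
    using f unfolding thompson_F_carrier_def by auto
  show ?thesis
  proof (rule thompson_F_carrierI)
    show "homeomorphism UNIV UNIV ?g f"
      using thompson_F_dest(5)[OF f] by (rule homeomorphism_symD)
    show "strict_mono ?g"
      unfolding strict_mono_def
      by (metis thompson_F_inv_apply(1)[OF f] thompson_F_less_iff(1)[OF f])
    show "finite (f ` breaks f)" "f ` breaks f \<subseteq> dyadic_rationals"
      using fb thompson_F_dest(6)[OF f] by auto
    show "dyadic_affine_at ?g y" if "y \<notin> f ` breaks f" for y
      using that dyadic_affine_at_inverse[OF f dyadic_affine_outside_breaks[OF f]]
      by (metis image_eqI thompson_F_inv_apply(1)[OF f])
    show "?g ` dyadic_rationals \<subseteq> dyadic_rationals"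
      using thompson_F_dyadic_iff[OF f] thompson_F_inv_apply(1)[OF f] by (metis image_subsetI)
    show "\<forall>\<^sub>F x in at_bot. ?g x = x + of_int (- i)"
      using eventually_compose_filterlim[OF fij(1) translation_at_bot[of "- of_int i"]]
      by eventually_elim (use thompson_F_inv_apply(2)[OF f] in \<open>metis (no_types, opaque_lifting) add.commute add_minus_cancel of_int_minus\<close>)
    show "\<forall>\<^sub>F x in at_top. ?g x = x + of_int (- j)"
      using eventually_compose_filterlim[OF fij(2) translation_at_top[of "- of_int j"]]
      by eventually_elim (use thompson_F_inv_apply(2)[OF f] in \<open>metis (no_types, opaque_lifting) add.commute add_minus_cancel of_int_minus\<close>)
  qed
qed

lemma translation_in_F: "(\<lambda>x. x + of_int n) \<in> thompson_F_carrier"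
proof (rule thompson_F_carrierI)
  show "homeomorphism UNIV UNIV (\<lambda>x. x + of_int n) (\<lambda>x. x - of_int n :: real)"
    unfolding homeomorphism_def by (auto intro!: continuous_intros simp: image_iff)
  show "strict_mono (\<lambda>x. x + of_int n :: real)" by (simp add: strict_mono_def)
  show "finite ({} :: real set)" "{} \<subseteq> dyadic_rationals" by simp_all
  show "dyadic_affine_at (\<lambda>x. x + of_int n) x" for x
    unfolding dyadic_affine_at_def by (rule exI[of _ 0], rule exI[of _ "of_int n"]) simp
  show "(\<lambda>x. x + of_int n) ` dyadic_rationals \<subseteq> dyadic_rationals"
    by (auto intro: dyadic_add dyadic_of_int)
  show "\<forall>\<^sub>F x in at_bot. x + of_int n = x + (of_int n :: real)"
    "\<forall>\<^sub>F x in at_top. x + of_int n = x + (of_int n :: real)" by simp_all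
qed

lemma group_thompson_F: "group thompson_F"
proof (rule groupI)
  have "id = (\<lambda>x. x + of_int 0 :: real)" by auto
  then show "\<one>\<^bsub>thompson_F\<^esub> \<in> carrier thompson_F"
    using translation_in_F[of 0] by (simp add: thompson_F_def)
  show "\<exists>y\<in>carrier thompson_F. y \<otimes>\<^bsub>thompson_F\<^esub> x = \<one>\<^bsub>thompson_F\<^esub>"
    if "x \<in> carrier thompson_F" for x
    using that thompson_F_inverse[of x] thompson_F_inv_apply[of x]
    by (intro bexI[of _ "inv_into UNIV x"]) (auto simp: thompson_F_def)
qed (auto simp: thompson_F_def thompson_F_compose comp_assoc)


lemma thompson_F_inv: "f \<in> thompson_F_carrier \<Longrightarrow> inv\<^bsub>thompson_F\<^esub> f = inv_into UNIV f"
  by (rule group.inv_equality[OF group_thompson_F])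
    (auto simp: thompson_F_def thompson_F_inverse thompson_F_inv_apply)

lemma thompson_F_nat_pow: "f [^]\<^bsub>thompson_F\<^esub> (n::nat) = f ^^ n"
proof (induction n)
  case 0
  then show ?case by (simp add: thompson_F_def)
next
  case (Suc n)
  then show ?case unfolding nat_pow_Suc funpow_Suc_right by (simp add: thompson_F_def)
qed

lemma thompson_F_mult: "f \<otimes>\<^bsub>thompson_F\<^esub> g = f \<circ> g"
  and thompson_F_one: "\<one>\<^bsub>thompson_F\<^esub> = id"
  and thompson_F_carrier_eq: "carrier thompson_F = thompson_F_carrier"
  by (simp_all add: thompson_F_def)

section \<open>Translation lengths at the two ends\<close>

definition shift_bot :: "(real \<Rightarrow> real) \<Rightarrow> int" where
  "shift_bot f = (THE i. \<forall>\<^sub>F x in at_bot. f x = x + of_int i)"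

definition shift_top :: "(real \<Rightarrow> real) \<Rightarrow> int" where
  "shift_top f = (THE j. \<forall>\<^sub>F x in at_top. f x = x + of_int j)"

lemma shift_bot_eqI:
  assumes "\<forall>\<^sub>F x in at_bot. f x = x + of_int i"
  shows "shift_bot f = i"
  unfolding shift_bot_def
proof (rule the_equality, fact assms)
  fix j assume "\<forall>\<^sub>F x in at_bot. f x = x + of_int j"
  with assms have "\<forall>\<^sub>F x::real in at_bot. j = i" by eventually_elim simp
  then show "j = i" by simp
qed

lemma shift_top_eqI:
  assumes "\<forall>\<^sub>F x in at_top. f x = x + of_int i"
  shows "shift_top f = i"
  unfolding shift_top_def
proof (rule the_equality, fact assms)
  fix j assume "\<forall>\<^sub>F x in at_top. f x = x + of_int j"
  with assms have "\<forall>\<^sub>F x::real in at_top. j = i" by eventually_elim simp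
  then show "j = i" by simp
qed

lemma eventually_shift:
  assumes "f \<in> thompson_F_carrier"
  shows "\<forall>\<^sub>F x in at_bot. f x = x + of_int (shift_bot f)"
    and "\<forall>\<^sub>F x in at_top. f x = x + of_int (shift_top f)"
  using assms by (metis thompson_F_ends shift_bot_eqI shift_top_eqI)+

lemma shift_compose:
  assumes "f \<in> thompson_F_carrier" "g \<in> thompson_F_carrier"
  shows "shift_bot (f \<circ> g) = shift_bot f + shift_bot g"
    and "shift_top (f \<circ> g) = shift_top f + shift_top g"
proof -
  show "shift_bot (f \<circ> g) = shift_bot f + shift_bot g"
    using at_bot_translation_compose[OF eventually_shift(1)[OF assms(1)] eventually_shift(1)[OF assms(2)]]
    by (intro shift_bot_eqI) simp
  show "shift_top (f \<circ> g) = shift_top f + shift_top g"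
    using at_top_translation_compose[OF eventually_shift(2)[OF assms(1)] eventually_shift(2)[OF assms(2)]]
    by (intro shift_top_eqI) simp
qed

lemma shift_translation:
  "shift_bot (\<lambda>x. x + of_int n) = n" "shift_top (\<lambda>x. x + of_int n) = n"
  by (auto intro!: shift_bot_eqI shift_top_eqI always_eventually)

lemma shift_id: "shift_bot id = 0" "shift_top id = 0"
  by (auto intro!: shift_bot_eqI shift_top_eqI always_eventually)

lemma shift_inverse:
  assumes "f \<in> thompson_F_carrier"
  shows "shift_bot (inv_into UNIV f) = - shift_bot f"
    and "shift_top (inv_into UNIV f) = - shift_top f"
proof -
  have "f \<circ> inv_into UNIV f = id" by (auto simp: thompson_F_inv_apply[OF assms])
  with shift_compose[OF assms thompson_F_inverse[OF assms]] shift_id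
  show "shift_bot (inv_into UNIV f) = - shift_bot f"
    and "shift_top (inv_into UNIV f) = - shift_top f" by simp_all
qed

lemma funpow_in_F: "f \<in> thompson_F_carrier \<Longrightarrow> f ^^ n \<in> thompson_F_carrier"
  using group.is_monoid[OF group_thompson_F, THEN monoid.nat_pow_closed, of f n]
  by (simp add: thompson_F_nat_pow thompson_F_carrier_eq)

lemma shift_funpow:
  assumes "f \<in> thompson_F_carrier"
  shows "shift_bot (f ^^ n) = int n * shift_bot f" "shift_top (f ^^ n) = int n * shift_top f"
  by (induction n) (simp_all add: shift_id[unfolded id_def] shift_id shift_compose[OF assms funpow_in_F[OF assms]]
    algebra_simps)

text \<open>
  The identity up to \<open>a\<close>, slope 2 on \<open>[a, a + 1]\<close>, and translation by 1 from there on; this map,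
  its inverse and the translations supply all the explicit elements of \<open>F\<close> that are needed.
\<close>

definition ramp :: "real \<Rightarrow> real \<Rightarrow> real" where
  "ramp a x = max x (min (2 * x - a) (x + 1))"

lemma ramp_id: "x \<le> a \<Longrightarrow> ramp a x = x"
  by (simp add: ramp_def)

lemma ramp_gt: "a < x \<Longrightarrow> x < ramp a x"
  by (simp add: ramp_def max_def min_def)

lemma ramp_translation: "a + 1 \<le> x \<Longrightarrow> ramp a x = x + 1"
  by (simp add: ramp_def max_def min_def)

lemma ramp_in_F:
  assumes a: "a \<in> dyadic_rationals"
  shows "ramp a \<in> thompson_F_carrier"
proof (rule thompson_F_carrierI)
  let ?g = "\<lambda>y. min y (max ((y + a) / 2) (y - 1))"
  have 1: "?g (ramp a x) = x" "ramp a (?g x) = x" for x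
    by (auto simp: ramp_def max_def min_def field_simps)
  have "continuous_on UNIV (ramp a)" "continuous_on UNIV ?g"
    unfolding ramp_def[abs_def] by (intro continuous_intros; simp)+
  with 1 show "homeomorphism UNIV UNIV (ramp a) ?g"
    unfolding homeomorphism_def by (metis (no_types, lifting) UNIV_I subsetI surjI top.extremum_uniqueI)
  show "strict_mono (ramp a)" by (auto simp: strict_mono_def ramp_def max_def min_def)
  show "finite {a, a + 1}" "{a, a + 1} \<subseteq> dyadic_rationals"
    using a dyadic_add[OF a dyadic_of_int[of 1]] by auto
  show "dyadic_affine_at (ramp a) x" if "x \<notin> {a, a + 1}" for x
  proof -
    have "x \<noteq> a" "x \<noteq> a + 1" using that by auto
    then consider "x < a" | "a < x" "x < a + 1" | "a + 1 < x" by linarith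
    then show ?thesis
    proof cases
      case 1
      then have "\<forall>\<^sub>F y in nhds x. y < a" by (rule order_tendstoD[OF filterlim_ident])
      then have "\<forall>\<^sub>F y in nhds x. ramp a y = 2 powi 0 * y + 0"
        by eventually_elim (simp add: ramp_id)
      then show ?thesis unfolding dyadic_affine_at_def by blast
    next
      case 2
      from order_tendstoD(1)[OF filterlim_ident 2(1)] order_tendstoD(2)[OF filterlim_ident 2(2)]
      have "\<forall>\<^sub>F y in nhds x. ramp a y = 2 powi 1 * y + (- a)"
        by eventually_elim (simp add: ramp_def)
      then show ?thesis unfolding dyadic_affine_at_def by blast
    next
      case 3
      then have "\<forall>\<^sub>F y in nhds x. a + 1 < y" by (rule order_tendstoD[OF filterlim_ident])
      then have "\<forall>\<^sub>F y in nhds x. ramp a y = 2 powi 0 * y + 1"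
        by eventually_elim (simp add: ramp_translation)
      then show ?thesis unfolding dyadic_affine_at_def by blast
    qed
  qed
  show "ramp a ` dyadic_rationals \<subseteq> dyadic_rationals"
  proof
    fix y assume "y \<in> ramp a ` dyadic_rationals"
    then obtain x where x: "x \<in> dyadic_rationals" "y = ramp a x" by blast
    have "2 * x \<in> dyadic_rationals" "x + 1 \<in> dyadic_rationals"
      using x dyadic_add[OF x(1) x(1)] dyadic_add[OF x(1) dyadic_of_int[of 1]] by auto
    then show "y \<in> dyadic_rationals"
      using x a dyadic_diff by (auto simp: ramp_def max_def min_def)
  qed
  show "\<forall>\<^sub>F x in at_bot. ramp a x = x + of_int 0"
    using eventually_le_at_bot[of a] by eventually_elim (simp add: ramp_id)
  show "\<forall>\<^sub>F x in at_top. ramp a x = x + of_int 1"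
    using eventually_ge_at_top[of "a + 1"] by eventually_elim (simp add: ramp_translation)
qed

lemma ramp_shift: "shift_bot (ramp a) = 0" "shift_top (ramp a) = 1"
proof -
  show "shift_bot (ramp a) = 0"
    by (rule shift_bot_eqI) (use eventually_le_at_bot[of a] in \<open>eventually_elim, simp add: ramp_id\<close>)
  show "shift_top (ramp a) = 1"
    by (rule shift_top_eqI)
      (use eventually_ge_at_top[of "a + 1"] in \<open>eventually_elim, simp add: ramp_translation\<close>)
qed

text \<open>
  The mirror image of a ramp, obtained as the translation by 1 after the inverse of a ramp: the two
  cancel near \<open>\<infinity>\<close>, and only the translation remains near \<open>- \<infinity>\<close>.
\<close>

lemma left_push_exists:
  fixes n :: int
  obtains r where "r \<in> thompson_F_carrier" "shift_bot r = 1" "shift_top r = 0"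
    "\<forall>x \<ge> of_int n. r x = x"
proof
  \<comment> \<open>The ramp from \<open>n - 2\<close> is a translation from \<open>n - 1\<close> on, so its inverse is one from \<open>n\<close> on.\<close>
  let ?T = "\<lambda>x::real. x + of_int 1" and ?s = "ramp (of_int (n - 2))"
  have s: "?s \<in> thompson_F_carrier" by (intro ramp_in_F dyadic_of_int)
  note si = thompson_F_inverse[OF s]
  show "?T \<circ> inv_into UNIV ?s \<in> thompson_F_carrier"
    by (intro thompson_F_compose translation_in_F si)
  show "shift_bot (?T \<circ> inv_into UNIV ?s) = 1" "shift_top (?T \<circ> inv_into UNIV ?s) = 0"
    by (simp_all only: shift_compose[OF translation_in_F si] shift_translation shift_inverse[OF s] ramp_shift)
  show "\<forall>x \<ge> of_int n. (?T \<circ> inv_into UNIV ?s) x = x"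
  proof (intro allI impI)
    fix x :: real assume "of_int n \<le> x"
    then have "?s (x - 1) = x" using ramp_translation[of "of_int (n - 2)" "x - 1"] by simp
    then show "(?T \<circ> inv_into UNIV ?s) x = x" using thompson_F_inv_apply(2)[OF s, of "x - 1"] by simp
  qed
qed

section \<open>Commutators as local models of arbitrary elements\<close>

lemma thompson_F_commutator:
  assumes "u \<in> thompson_F_carrier" "v \<in> thompson_F_carrier"
  shows "(u \<otimes>\<^bsub>thompson_F\<^esub> v \<otimes>\<^bsub>thompson_F\<^esub> inv\<^bsub>thompson_F\<^esub> u \<otimes>\<^bsub>thompson_F\<^esub> inv\<^bsub>thompson_F\<^esub> v)
    = u \<circ> v \<circ> inv_into UNIV u \<circ> inv_into UNIV v"
  using assms by (simp add: thompson_F_mult thompson_F_inv)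

lemma identity_off_compact:
  assumes "u \<in> thompson_F_carrier" "shift_bot u = 0" "shift_top u = 0"
  obtains n :: nat where "\<forall>x \<le> - real n. u x = x" "\<forall>x \<ge> real n. u x = x"
proof -
  obtain B C where "\<And>x. x \<le> B \<Longrightarrow> u x = x" "\<And>x. x \<ge> C \<Longrightarrow> u x = x"
    using eventually_shift[OF assms(1)] assms(2,3)
    unfolding eventually_at_bot_linorder eventually_at_top_linorder by auto
  moreover obtain n :: nat where "max \<bar>B\<bar> \<bar>C\<bar> \<le> real n" using real_arch_simple by blast
  ultimately show ?thesis by (intro that[of n]) auto
qed

text \<open>
  Composing on the left with elements that are the identity on a large interval does not change \<open>g\<close>
  on \<open>[-A, A]\<close>. Powers of a ramp far to the right and of its mirror image far to the left bring both
  translation lengths to 0.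
\<close>

lemma compact_truncation:
  assumes g: "g \<in> thompson_F_carrier"
  obtains u where "u \<in> thompson_F_carrier" "shift_bot u = 0" "shift_top u = 0"
    "\<forall>x. \<bar>x\<bar> \<le> A \<longrightarrow> u x = g x"
proof -
  define P where "P f \<longleftrightarrow> f \<in> thompson_F_carrier \<and> (\<forall>x. \<bar>x\<bar> \<le> A \<longrightarrow> f x = g x)" for f
  obtain n :: nat where "max \<bar>g (-A)\<bar> \<bar>g A\<bar> \<le> real n" using real_arch_simple by blast
  then have n: "- real n \<le> g x" "g x \<le> real n" if "\<bar>x\<bar> \<le> A" for x
    using that thompson_F_less_iff(2)[OF g, of x A] thompson_F_less_iff(2)[OF g, of "-A" x] by auto
  have supp: "P (r \<circ> f)"
    if "P f" "r \<in> thompson_F_carrier" "\<And>x. \<bar>x\<bar> \<le> real n \<Longrightarrow> r x = x" for r f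
  proof -
    have "\<bar>g x\<bar> \<le> real n" if "\<bar>x\<bar> \<le> A" for x using n[OF that] by linarith
    then show ?thesis using that unfolding P_def by (auto intro!: thompson_F_compose)
  qed
  have pow_id: "(r ^^ m) x = x" if "r x = x" for r :: "real \<Rightarrow> real" and m x
    using that by (induction m) auto
  have inv_id: "inv_into UNIV r x = x" if "r \<in> thompson_F_carrier" "r x = x" for r x
    using that thompson_F_inv_apply(2)[of r x] by simp
  \<comment> \<open>A possibly negative power of \<open>s\<close>, to cancel translation lengths of either sign.\<close>
  have signed_power: "\<exists>r. r \<in> thompson_F_carrier \<and> (\<forall>x. \<bar>x\<bar> \<le> real n \<longrightarrow> r x = x) \<and>
      shift_bot r = m * shift_bot s \<and> shift_top r = m * shift_top s"
    if s: "s \<in> thompson_F_carrier" "\<And>x. \<bar>x\<bar> \<le> real n \<Longrightarrow> s x = x" for s and m :: int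
  proof (cases "m \<ge> 0")
    case True
    then show ?thesis
      using s by (intro exI[of _ "s ^^ nat m"]) (auto simp: funpow_in_F pow_id shift_funpow)
  next
    case False
    note i = thompson_F_inverse[OF s(1)]
    show ?thesis
      using s False by (intro exI[of _ "inv_into UNIV s ^^ nat (-m)"])
        (auto simp: funpow_in_F[OF i] pow_id inv_id shift_funpow[OF i] shift_inverse)
  qed
  have "ramp (of_int (int n)) \<in> thompson_F_carrier" by (intro ramp_in_F dyadic_of_int)
  then obtain p where p: "p \<in> thompson_F_carrier" "\<And>x. \<bar>x\<bar> \<le> real n \<Longrightarrow> p x = x"
    "shift_bot p = 0" "shift_top p = - shift_top g"
    using signed_power[of "ramp (of_int (int n))" "- shift_top g"] by (auto simp: ramp_id ramp_shift)
  obtain r where "r \<in> thompson_F_carrier" "shift_bot r = 1" "shift_top r = 0"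
    "\<forall>x \<ge> of_int (- int n). r x = x" using left_push_exists .
  note r = this[rule_format]
  obtain q where q: "q \<in> thompson_F_carrier" "\<And>x. \<bar>x\<bar> \<le> real n \<Longrightarrow> q x = x"
    "shift_bot q = - shift_bot g" "shift_top q = 0"
    using signed_power[of r "- shift_bot g"] r by (auto simp: abs_le_iff)
  have "P g" using g by (simp add: P_def)
  then have "P (q \<circ> (p \<circ> g))" using p q supp by blast
  moreover have "shift_bot (q \<circ> (p \<circ> g)) = 0" "shift_top (q \<circ> (p \<circ> g)) = 0"
    using g p q by (simp_all add: shift_compose thompson_F_compose)
  ultimately show ?thesis using that unfolding P_def by blast
qed

text \<open>
  Let \<open>u\<close> be a compactly supported truncation of \<open>g\<close>. In \<open>u (v u\<^sup>-\<^sup>1 v\<^sup>-\<^sup>1)\<close> with \<open>v\<close> a long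
  translation, the second factor is supported far away from \<open>[-A, A]\<close>.
\<close>

lemma commutator_realizes_locally:
  assumes g: "g \<in> thompson_F_carrier"
  obtains u v where "u \<in> thompson_F_carrier" "v \<in> thompson_F_carrier"
    "\<forall>x. \<bar>x\<bar> \<le> A \<longrightarrow> (u \<circ> v \<circ> inv_into UNIV u \<circ> inv_into UNIV v) x = g x"
proof -
  obtain u where "u \<in> thompson_F_carrier" "shift_bot u = 0" "shift_top u = 0"
    "\<forall>x. \<bar>x\<bar> \<le> A \<longrightarrow> u x = g x" using compact_truncation[OF g] .
  note u = this[rule_format]
  obtain n :: nat where "\<forall>x \<le> - real n. u x = x" "\<forall>x \<ge> real n. u x = x"
    using identity_off_compact[OF u(1-3)] .
  note n = this(1)[rule_format]
  obtain m :: nat where m: "A + real n \<le> real m" using real_arch_simple by blast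
  let ?v = "\<lambda>x::real. x + of_int (int m)"
  have v: "?v \<in> thompson_F_carrier" by (rule translation_in_F)
  show ?thesis
  proof (rule that[OF u(1) v], intro allI impI)
    fix x :: real assume x: "\<bar>x\<bar> \<le> A"
    have "inv_into UNIV ?v x = x - real m"
      using thompson_F_inv_apply(2)[OF v, of "x - real m"] by simp
    moreover have "inv_into UNIV u (x - real m) = x - real m"
      using n[of "x - real m"] x m thompson_F_inv_apply(2)[OF u(1), of "x - real m"] by simp
    ultimately show "(u \<circ> ?v \<circ> inv_into UNIV u \<circ> inv_into UNIV ?v) x = g x"
      using u(4)[OF x] by simp
  qed
qed

text \<open>
  A ramp that starts between a moved point and its image fixes one of the two and moves the other.
\<close>

lemma center_trivial:
  assumes k: "k \<in> thompson_F_carrier" "k \<noteq> id"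
  obtains g y where "g \<in> thompson_F_carrier" "g (k y) \<noteq> k (g y)"
proof -
  obtain y where y: "k y \<noteq> y" using k(2) by (metis eq_id_iff)
  then have "min y (k y) < max y (k y)" by (simp add: min_def max_def)
  from dyadic_dense[OF this] obtain d where d: "d \<in> dyadic_rationals" "min y (k y) < d" "d < max y (k y)" .
  show ?thesis
  proof
    show "ramp d \<in> thompson_F_carrier" using d(1) by (rule ramp_in_F)
    show "ramp d (k y) \<noteq> k (ramp d y)"
    proof (cases "y < k y")
      case True
      then show ?thesis using d ramp_id[of y d] ramp_gt[of d "k y"] by auto
    next
      case False
      then have "ramp d (k y) = k y" "ramp d y \<noteq> y"
        using d y ramp_id[of "k y" d] ramp_gt[of d y] by auto
      then show ?thesis by (simp add: thompson_F_less_iff(3)[OF k(1)])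
    qed
  qed
qed

section \<open>A group-theoretic description of a quadrant of translation lengths\<close>

text \<open>
  The condition uses commutators, rather than all compactly supported elements, so that it refers to
  the group structure only and is preserved by isomorphisms.
\<close>

definition displaces_commutators :: "('a, 'b) monoid_scheme \<Rightarrow> 'a \<Rightarrow> bool" where
  "displaces_commutators G f \<longleftrightarrow> (\<exists>k\<in>carrier G. k \<noteq> \<one>\<^bsub>G\<^esub> \<and>
     (\<forall>u\<in>carrier G. \<forall>v\<in>carrier G. \<forall>\<^sub>F n::nat in sequentially.
        let c = f [^]\<^bsub>G\<^esub> n \<otimes>\<^bsub>G\<^esub> (u \<otimes>\<^bsub>G\<^esub> v \<otimes>\<^bsub>G\<^esub> inv\<^bsub>G\<^esub> u \<otimes>\<^bsub>G\<^esub> inv\<^bsub>G\<^esub> v) \<otimes>\<^bsub>G\<^esub> inv\<^bsub>G\<^esub> (f [^]\<^bsub>G\<^esub> n)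
        in c \<otimes>\<^bsub>G\<^esub> k = k \<otimes>\<^bsub>G\<^esub> c))"

lemma displaces_commutators_iso_imp:
  assumes G: "group G" and \<phi>: "\<phi> \<in> iso G G" and f: "f \<in> carrier G"
    and E: "displaces_commutators G f"
  shows "displaces_commutators G (\<phi> f)"
proof -
  interpret group_hom G G \<phi>
    using G \<phi> by (auto simp: group_hom_def group_hom_axioms_def iso_def)
  have bij: "bij_betw \<phi> (carrier G) (carrier G)" using \<phi> by (simp add: iso_def)
  let ?c = "\<lambda>f u v n. f [^]\<^bsub>G\<^esub> (n::nat) \<otimes>\<^bsub>G\<^esub> (u \<otimes>\<^bsub>G\<^esub> v \<otimes>\<^bsub>G\<^esub> inv\<^bsub>G\<^esub> u \<otimes>\<^bsub>G\<^esub> inv\<^bsub>G\<^esub> v) \<otimes>\<^bsub>G\<^esub> inv\<^bsub>G\<^esub> (f [^]\<^bsub>G\<^esub> n)"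
  obtain k where k: "k \<in> carrier G" "k \<noteq> \<one>\<^bsub>G\<^esub>"
    "\<And>u v. u \<in> carrier G \<Longrightarrow> v \<in> carrier G \<Longrightarrow> \<forall>\<^sub>F n in sequentially. ?c f u v n \<otimes>\<^bsub>G\<^esub> k = k \<otimes>\<^bsub>G\<^esub> ?c f u v n"
    using E unfolding displaces_commutators_def Let_def by blast
  have "\<phi> k \<in> carrier G" "\<phi> k \<noteq> \<one>\<^bsub>G\<^esub>"
    using inj_onD[OF bij_betw_imp_inj_on[OF bij], of k "\<one>\<^bsub>G\<^esub>"] k by auto
  moreover have "\<forall>\<^sub>F n in sequentially. ?c (\<phi> f) u' v' n \<otimes>\<^bsub>G\<^esub> \<phi> k = \<phi> k \<otimes>\<^bsub>G\<^esub> ?c (\<phi> f) u' v' n"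
    if uv': "u' \<in> carrier G" "v' \<in> carrier G" for u' v'
  proof -
    obtain u v where uv: "u \<in> carrier G" "v \<in> carrier G" "u' = \<phi> u" "v' = \<phi> v"
      using uv' bij by (metis bij_betw_def imageE)
    have c: "?c (\<phi> f) u' v' n = \<phi> (?c f u v n)" "?c f u v n \<in> carrier G" for n
      using uv f by (simp_all add: hom_nat_pow)
    from k(3)[OF uv(1,2)] show ?thesis
      by eventually_elim (simp only: c(1) hom_mult[symmetric] c(2) k(1))
  qed
  ultimately show ?thesis
    unfolding displaces_commutators_def Let_def by (intro bexI[of _ "\<phi> k"] conjI ballI)
qed

lemma displaces_commutators_iso:
  assumes G: "group G" and \<phi>: "\<phi> \<in> iso G G" and f: "f \<in> carrier G"
  shows "displaces_commutators G (\<phi> f) \<longleftrightarrow> displaces_commutators G f"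
proof
  assume "displaces_commutators G (\<phi> f)"
  moreover have "\<phi> f \<in> carrier G" using \<phi> f by (auto simp: iso_def hom_def)
  ultimately have "displaces_commutators G (inv_into (carrier G) \<phi> (\<phi> f))"
    using displaces_commutators_iso_imp[OF G group.iso_set_sym[OF G \<phi>]] by blast
  moreover have "inv_into (carrier G) \<phi> (\<phi> f) = f"
    using \<phi> f by (simp add: iso_def bij_betw_def)
  ultimately show "displaces_commutators G f" by simp
qed (rule displaces_commutators_iso_imp[OF assms])

lemma commute_separated:
  assumes c: "c \<in> thompson_F_carrier" and k: "k \<in> thompson_F_carrier"
    and "\<And>x. x \<le> a \<Longrightarrow> c x = x" "\<And>x. a \<le> x \<Longrightarrow> k x = x"
  shows "c \<circ> k = k \<circ> c"
proof
  fix x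
  have ka: "k a = a" "c a = a" using assms(3,4) by simp_all
  show "(c \<circ> k) x = (k \<circ> c) x"
  proof (cases "x \<le> a")
    case True
    then have "k x \<le> a" using thompson_F_less_iff(2)[OF k, of x a] ka by simp
    then show ?thesis using assms(3)[OF True] assms(3)[of "k x"] by simp
  next
    case False
    then have "a \<le> c x" using thompson_F_less_iff(2)[OF c, of a x] ka by simp
    then show ?thesis using assms(4)[of x] assms(4)[of "c x"] False by simp
  qed
qed

lemma displaces_commutatorsI:
  assumes f: "f \<in> thompson_F_carrier" and k: "k \<in> thompson_F_carrier" "k \<noteq> id"
    and comm: "\<And>c. c \<in> thompson_F_carrier \<Longrightarrow> shift_bot c = 0 \<Longrightarrow> shift_top c = 0 \<Longrightarrow>
      \<forall>\<^sub>F n in sequentially. (f ^^ n \<circ> c \<circ> inv_into UNIV (f ^^ n)) \<circ> k = k \<circ> (f ^^ n \<circ> c \<circ> inv_into UNIV (f ^^ n))"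
  shows "displaces_commutators thompson_F f"
  unfolding displaces_commutators_def Let_def
proof (intro bexI[of _ k] conjI ballI)
  fix u v assume "u \<in> carrier thompson_F" "v \<in> carrier thompson_F"
  then have uv: "u \<in> thompson_F_carrier" "v \<in> thompson_F_carrier" by (simp_all add: thompson_F_carrier_eq)
  have "u \<circ> v \<circ> inv_into UNIV u \<circ> inv_into UNIV v \<in> thompson_F_carrier"
    "shift_bot (u \<circ> v \<circ> inv_into UNIV u \<circ> inv_into UNIV v) = 0"
    "shift_top (u \<circ> v \<circ> inv_into UNIV u \<circ> inv_into UNIV v) = 0"
    using uv by (simp_all add: thompson_F_compose thompson_F_inverse shift_compose shift_inverse)
  from comm[OF this] show "\<forall>\<^sub>F n::nat in sequentially.
     f [^]\<^bsub>thompson_F\<^esub> n \<otimes>\<^bsub>thompson_F\<^esub>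
       (u \<otimes>\<^bsub>thompson_F\<^esub> v \<otimes>\<^bsub>thompson_F\<^esub> inv\<^bsub>thompson_F\<^esub> u \<otimes>\<^bsub>thompson_F\<^esub> inv\<^bsub>thompson_F\<^esub> v) \<otimes>\<^bsub>thompson_F\<^esub>
       inv\<^bsub>thompson_F\<^esub> (f [^]\<^bsub>thompson_F\<^esub> n) \<otimes>\<^bsub>thompson_F\<^esub> k =
     k \<otimes>\<^bsub>thompson_F\<^esub> (f [^]\<^bsub>thompson_F\<^esub> n \<otimes>\<^bsub>thompson_F\<^esub>
       (u \<otimes>\<^bsub>thompson_F\<^esub> v \<otimes>\<^bsub>thompson_F\<^esub> inv\<^bsub>thompson_F\<^esub> u \<otimes>\<^bsub>thompson_F\<^esub> inv\<^bsub>thompson_F\<^esub> v) \<otimes>\<^bsub>thompson_F\<^esub>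
       inv\<^bsub>thompson_F\<^esub> (f [^]\<^bsub>thompson_F\<^esub> n))"
    unfolding thompson_F_commutator[OF uv] unfolding thompson_F_nat_pow
      thompson_F_inv[OF funpow_in_F[OF f]] thompson_F_mult .
qed (use k in \<open>simp_all add: thompson_F_carrier_eq thompson_F_one\<close>)

text \<open>
  The witness \<open>k\<close> is supported where \<open>f\<close> is a translation to the right. For large \<open>n\<close> the power
  \<open>f\<^sup>n\<close> has carried the support of \<open>c\<close> past the support of \<open>k\<close>.
\<close>

lemma displaces_of_shift_bot_pos:
  assumes f: "f \<in> thompson_F_carrier" and pos: "0 < shift_bot f"
  shows "displaces_commutators thompson_F f"
proof -
  obtain b where b: "\<And>x. x \<le> b \<Longrightarrow> f x = x + of_int (shift_bot f)"
    using eventually_shift(1)[OF f] unfolding eventually_at_bot_linorder by blast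
  define m where "m = \<lfloor>b\<rfloor>"
  have push: "min (of_int m) (x + real n) \<le> (f ^^ n) x" for x n
  proof (induction n)
    case (Suc n)
    let ?y = "(f ^^ n) x"
    have one: "z + 1 \<le> f z" if "z \<le> of_int m" for z
    proof -
      have "z \<le> b" using that unfolding m_def by linarith
      moreover have "1 \<le> real_of_int (shift_bot f)" using pos by linarith
      ultimately show ?thesis using b[of z] by linarith
    qed
    show ?case
    proof (cases "?y \<le> of_int m")
      case True
      then show ?thesis using one[OF True] Suc by auto
    next
      case False
      then show ?thesis using one[of "of_int m"] thompson_F_less_iff(2)[OF f, of "of_int m" ?y] by auto
    qed
  qed simp
  obtain k where "k \<in> thompson_F_carrier" "shift_bot k = 1" "shift_top k = 0"
    "\<forall>x \<ge> of_int m. k x = x" using left_push_exists .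
  note k = this[rule_format]
  show ?thesis
  proof (rule displaces_commutatorsI[OF f k(1)])
    show "k \<noteq> id" using k(2) shift_id by auto
    fix c assume c: "c \<in> thompson_F_carrier" "shift_bot c = 0" "shift_top c = 0"
    obtain N :: nat where N: "\<forall>x \<le> - real N. c x = x" "\<forall>x \<ge> real N. c x = x"
      using identity_off_compact[OF c] .
    obtain n0 :: nat where n0: "of_int m + real N \<le> real n0" using real_arch_simple by blast
    have "(f ^^ n \<circ> c \<circ> inv_into UNIV (f ^^ n)) \<circ> k = k \<circ> (f ^^ n \<circ> c \<circ> inv_into UNIV (f ^^ n))"
      if n: "n0 \<le> n" for n
    proof (rule commute_separated[OF _ k(1) _ k(4)])
      note fn = funpow_in_F[OF f, of n]
      show "f ^^ n \<circ> c \<circ> inv_into UNIV (f ^^ n) \<in> thompson_F_carrier"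
        by (intro thompson_F_compose thompson_F_inverse fn c(1))
      fix x :: real assume "x \<le> of_int m"
      moreover have "of_int m \<le> (f ^^ n) (- real N)" using push[of "- real N" n] n n0 by auto
      ultimately have "inv_into UNIV (f ^^ n) x \<le> - real N"
        by (metis order_trans thompson_F_inv_apply(1)[OF fn] thompson_F_less_iff(2)[OF fn])
      then show "(f ^^ n \<circ> c \<circ> inv_into UNIV (f ^^ n)) x = x"
        using N by (simp add: thompson_F_inv_apply(1)[OF fn])
    qed
    then show "\<forall>\<^sub>F n in sequentially. (f ^^ n \<circ> c \<circ> inv_into UNIV (f ^^ n)) \<circ> k = k \<circ> (f ^^ n \<circ> c \<circ> inv_into UNIV (f ^^ n))"
      unfolding eventually_sequentially by blast
  qed
qed

lemma displaces_of_shift_top_neg: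
  assumes f: "f \<in> thompson_F_carrier" and neg: "shift_top f < 0"
  shows "displaces_commutators thompson_F f"
proof -
  obtain b where b: "\<And>x. b \<le> x \<Longrightarrow> f x = x + of_int (shift_top f)"
    using eventually_shift(2)[OF f] unfolding eventually_at_top_linorder by blast
  define m where "m = \<lceil>b\<rceil>"
  have push: "(f ^^ n) x \<le> max (of_int m) (x - real n)" for x n
  proof (induction n)
    case (Suc n)
    let ?y = "(f ^^ n) x"
    have one: "f z \<le> z - 1" if "of_int m \<le> z" for z
    proof -
      have "b \<le> z" using that unfolding m_def by linarith
      moreover have "real_of_int (shift_top f) \<le> - 1" using neg by linarith
      ultimately show ?thesis using b[of z] by linarith
    qed
    show ?case
    proof (cases "of_int m \<le> ?y")
      case True
      then show ?thesis using one[OF True] Suc by auto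
    next
      case False
      then show ?thesis using one[of "of_int m"] thompson_F_less_iff(2)[OF f, of ?y "of_int m"] by auto
    qed
  qed simp
  let ?k = "ramp (of_int m)"
  have k: "?k \<in> thompson_F_carrier" by (intro ramp_in_F dyadic_of_int)
  show ?thesis
  proof (rule displaces_commutatorsI[OF f k])
    show "?k \<noteq> id" using ramp_shift(2) shift_id by (metis zero_neq_one)
    fix c assume c: "c \<in> thompson_F_carrier" "shift_bot c = 0" "shift_top c = 0"
    obtain N :: nat where N: "\<forall>x \<le> - real N. c x = x" "\<forall>x \<ge> real N. c x = x"
      using identity_off_compact[OF c] .
    obtain n0 :: nat where n0: "real N - of_int m \<le> real n0" using real_arch_simple by blast
    have "?k \<circ> (f ^^ n \<circ> c \<circ> inv_into UNIV (f ^^ n)) = (f ^^ n \<circ> c \<circ> inv_into UNIV (f ^^ n)) \<circ> ?k"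
      if n: "n0 \<le> n" for n
    proof (rule commute_separated[OF k _ ramp_id])
      note fn = funpow_in_F[OF f, of n]
      show "f ^^ n \<circ> c \<circ> inv_into UNIV (f ^^ n) \<in> thompson_F_carrier"
        by (intro thompson_F_compose thompson_F_inverse fn c(1))
      fix x :: real assume "of_int m \<le> x"
      moreover have "(f ^^ n) (real N) \<le> of_int m" using push[of n "real N"] n n0 by auto
      ultimately have "real N \<le> inv_into UNIV (f ^^ n) x"
        by (metis order_trans thompson_F_inv_apply(1)[OF fn] thompson_F_less_iff(2)[OF fn])
      then show "(f ^^ n \<circ> c \<circ> inv_into UNIV (f ^^ n)) x = x"
        using N by (simp add: thompson_F_inv_apply(1)[OF fn])
    qed
    then show "\<forall>\<^sub>F n in sequentially. (f ^^ n \<circ> c \<circ> inv_into UNIV (f ^^ n)) \<circ> ?k = ?k \<circ> (f ^^ n \<circ> c \<circ> inv_into UNIV (f ^^ n))"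
      unfolding eventually_sequentially by metis
  qed
qed

text \<open>
  Once \<open>-A\<close> and \<open>A\<close> lie where \<open>f\<close> is a translation, \<open>f\<close> moves both weakly outwards, so
  \<open>f\<^sup>n\<close> maps \<open>[-A, A]\<close> onto a superset of itself.
\<close>

lemma expanding_preimage_bounded:
  assumes f: "f \<in> thompson_F_carrier" and sh: "shift_bot f \<le> 0" "0 \<le> shift_top f"
  obtains A where "C \<le> A" "\<forall>n x. \<bar>x\<bar> \<le> A \<longrightarrow> \<bar>inv_into UNIV (f ^^ n) x\<bar> \<le> A"
proof -
  obtain a b where ab: "\<And>x. x \<le> a \<Longrightarrow> f x = x + of_int (shift_bot f)"
    "\<And>x. b \<le> x \<Longrightarrow> f x = x + of_int (shift_top f)"
    using eventually_shift[OF f] unfolding eventually_at_top_linorder eventually_at_bot_linorder by blast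
  define A where "A = max C (max \<bar>a\<bar> \<bar>b\<bar>)"
  have "f (- A) = - A + of_int (shift_bot f)" "f A = A + of_int (shift_top f)"
    by (intro ab; simp add: A_def; linarith)+
  then have fA: "f (- A) \<le> - A" "A \<le> f A" using sh by auto
  have fnA: "(f ^^ n) (- A) \<le> - A \<and> A \<le> (f ^^ n) A" for n
  proof (induction n)
    case (Suc n)
    then have "f ((f ^^ n) (- A)) \<le> f (- A)" "f A \<le> f ((f ^^ n) A)"
      by (simp_all add: thompson_F_less_iff(2)[OF f])
    with fA show ?case by simp
  qed simp
  have "\<bar>inv_into UNIV (f ^^ n) x\<bar> \<le> A" if "\<bar>x\<bar> \<le> A" for n x
  proof -
    note fn = funpow_in_F[OF f, of n]
    let ?y = "inv_into UNIV (f ^^ n) x"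
    have "(f ^^ n) (- A) \<le> (f ^^ n) ?y" "(f ^^ n) ?y \<le> (f ^^ n) A"
      using fnA[of n] that by (auto simp: thompson_F_inv_apply(1)[OF fn])
    then show ?thesis by (simp add: thompson_F_less_iff(2)[OF fn] abs_le_iff)
  qed
  moreover have "C \<le> A" by (simp add: A_def)
  ultimately show ?thesis using that by blast
qed

text \<open>
  Given a candidate \<open>k\<close>, the commutator \<open>c\<close> is chosen to look like \<open>f\<close> if \<open>f\<close> does not commute with
  \<open>k\<close>, and otherwise like any element that does not commute with \<open>k\<close>. In the first case
  \<open>f\<^sup>n c f\<^sup>-\<^sup>n\<close> still looks like \<open>f\<close>; in the second it commutes with \<open>k\<close> only if \<open>c\<close> does.
\<close>

lemma not_displaces:
  assumes f: "f \<in> thompson_F_carrier" and sh: "shift_bot f \<le> 0" "0 \<le> shift_top f"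
  shows "\<not> displaces_commutators thompson_F f"
proof
  assume "displaces_commutators thompson_F f"
  then obtain k where k: "k \<in> thompson_F_carrier" "k \<noteq> id"
    and comm': "\<forall>u\<in>thompson_F_carrier. \<forall>v\<in>thompson_F_carrier. \<forall>\<^sub>F n::nat in sequentially.
      f [^]\<^bsub>thompson_F\<^esub> n \<otimes>\<^bsub>thompson_F\<^esub>
        (u \<otimes>\<^bsub>thompson_F\<^esub> v \<otimes>\<^bsub>thompson_F\<^esub> inv\<^bsub>thompson_F\<^esub> u \<otimes>\<^bsub>thompson_F\<^esub> inv\<^bsub>thompson_F\<^esub> v) \<otimes>\<^bsub>thompson_F\<^esub>
        inv\<^bsub>thompson_F\<^esub> (f [^]\<^bsub>thompson_F\<^esub> n) \<otimes>\<^bsub>thompson_F\<^esub> k =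
      k \<otimes>\<^bsub>thompson_F\<^esub> (f [^]\<^bsub>thompson_F\<^esub> n \<otimes>\<^bsub>thompson_F\<^esub>
        (u \<otimes>\<^bsub>thompson_F\<^esub> v \<otimes>\<^bsub>thompson_F\<^esub> inv\<^bsub>thompson_F\<^esub> u \<otimes>\<^bsub>thompson_F\<^esub> inv\<^bsub>thompson_F\<^esub> v) \<otimes>\<^bsub>thompson_F\<^esub>
        inv\<^bsub>thompson_F\<^esub> (f [^]\<^bsub>thompson_F\<^esub> n))"
    unfolding displaces_commutators_def Let_def thompson_F_carrier_eq thompson_F_one by (elim bexE conjE)
  have comm: "\<forall>\<^sub>F n in sequentially.
      (f ^^ n \<circ> (u \<circ> v \<circ> inv_into UNIV u \<circ> inv_into UNIV v) \<circ> inv_into UNIV (f ^^ n)) \<circ> k =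
      k \<circ> (f ^^ n \<circ> (u \<circ> v \<circ> inv_into UNIV u \<circ> inv_into UNIV v) \<circ> inv_into UNIV (f ^^ n))"
    if uv: "u \<in> thompson_F_carrier" "v \<in> thompson_F_carrier" for u v
    using comm'[THEN bspec, OF uv(1), THEN bspec, OF uv(2)]
    unfolding thompson_F_commutator[OF uv] unfolding thompson_F_nat_pow
      thompson_F_inv[OF funpow_in_F[OF f]] thompson_F_mult .
  obtain g y where g: "g \<in> thompson_F_carrier" "g (k y) \<noteq> k (g y)"
    and gf: "g = f \<or> f \<circ> k = k \<circ> f"
    using center_trivial[OF k] f by (metis comp_apply ext)
  obtain A where "max \<bar>y\<bar> \<bar>k y\<bar> \<le> A" "\<forall>n x. \<bar>x\<bar> \<le> A \<longrightarrow> \<bar>inv_into UNIV (f ^^ n) x\<bar> \<le> A"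
    using expanding_preimage_bounded[OF f sh] .
  note A = this[rule_format]
  obtain u v where "u \<in> thompson_F_carrier" "v \<in> thompson_F_carrier"
    "\<forall>x. \<bar>x\<bar> \<le> A \<longrightarrow> (u \<circ> v \<circ> inv_into UNIV u \<circ> inv_into UNIV v) x = g x"
    using commutator_realizes_locally[OF g(1)] .
  note uv = this[rule_format]
  define c where "c = u \<circ> v \<circ> inv_into UNIV u \<circ> inv_into UNIV v"
  obtain n where n: "(f ^^ n \<circ> c \<circ> inv_into UNIV (f ^^ n)) \<circ> k = k \<circ> (f ^^ n \<circ> c \<circ> inv_into UNIV (f ^^ n))"
    using comm[OF uv(1,2)] unfolding c_def[symmetric] eventually_sequentially by blast
  note fn = funpow_in_F[OF f, of n]
  let ?h = "inv_into UNIV (f ^^ n)"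
  have cg: "c x = g x" if "\<bar>x\<bar> \<le> A" for x using uv(3)[OF that] unfolding c_def .
  from gf show False
  proof
    assume "g = f"
    \<comment> \<open>On \<open>[-A, A]\<close> the conjugate of \<open>c\<close> is a conjugate of \<open>f\<close> by its own power, that is \<open>f\<close>.\<close>
    have conj: "(f ^^ n) (c (?h x)) = g x" if "\<bar>x\<bar> \<le> A" for x
    proof -
      have "c (?h x) = f (?h x)" using cg A(2)[OF that] \<open>g = f\<close> by simp
      then have "(f ^^ n) (c (?h x)) = f ((f ^^ n) (?h x))" by (simp add: funpow_swap1)
      then show ?thesis using \<open>g = f\<close> by (simp add: thompson_F_inv_apply(1)[OF fn])
    qed
    have "g (k y) = k (g y)"
      using fun_cong[OF n, of y] conj[of y] conj[of "k y"] A(1) by simp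
    with g(2) show False by simp
  next
    assume fk: "f \<circ> k = k \<circ> f"
    have fnk: "(f ^^ n) (k x) = k ((f ^^ n) x)" for x
      by (induction n) (use fk in \<open>auto dest: fun_cong simp: fun_eq_iff\<close>)
    have "(f ^^ n) (c (k y)) = (f ^^ n) (k (c y))"
      using fun_cong[OF n, of "(f ^^ n) y"] 
      by (simp add: fnk[symmetric] thompson_F_inv_apply(2)[OF fn])
    then have "c (k y) = k (c y)" by (simp add: thompson_F_less_iff(3)[OF fn])
    then show False using g(2) cg[of y] cg[of "k y"] A(1) by simp
  qed
qed

lemma displaces_commutators_iff:
  assumes "f \<in> thompson_F_carrier"
  shows "displaces_commutators thompson_F f \<longleftrightarrow> 0 < shift_bot f \<or> shift_top f < 0"
  using assms displaces_of_shift_bot_pos displaces_of_shift_top_neg not_displaces by (meson not_le)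

section \<open>Automorphisms preserving a quadrant\<close>

text \<open>
  A quadrant element of weight \<open>n\<close> is a product of \<open>n\<close> elements of weight 1 and one of weight 0, all
  in the quadrant. A nonzero pair in the quadrant is one whose negative lies outside, and this is
  preserved by \<open>\<phi>\<close>; so each factor of weight 1 is sent to a quadrant element of weight at least 1.
\<close>

lemma quadrant_weight_le:
  fixes p q :: "'a \<Rightarrow> int"
  assumes "group G" and p: "\<And>x y. x \<in> carrier G \<Longrightarrow> y \<in> carrier G \<Longrightarrow> p (x \<otimes>\<^bsub>G\<^esub> y) = p x + p y"
    and q: "\<And>x y. x \<in> carrier G \<Longrightarrow> y \<in> carrier G \<Longrightarrow> q (x \<otimes>\<^bsub>G\<^esub> y) = q x + q y"
    and a: "a \<in> carrier G" "p a = 1" "q a = 0" and b: "b \<in> carrier G" "p b = 0" "q b = 1"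
    and \<phi>: "\<phi> \<in> hom G G"
    and inv: "\<And>x. x \<in> carrier G \<Longrightarrow> 0 \<le> p (\<phi> x) \<and> 0 \<le> q (\<phi> x) \<longleftrightarrow> 0 \<le> p x \<and> 0 \<le> q x"
    and f: "f \<in> carrier G" "0 \<le> p f" "0 \<le> q f"
  shows "p f + q f \<le> p (\<phi> f) + q (\<phi> f)"
proof -
  interpret group_hom G G \<phi>
    using assms(1) \<phi> by (auto simp: group_hom_def group_hom_axioms_def)
  have one: "p \<one>\<^bsub>G\<^esub> = 0" "q \<one>\<^bsub>G\<^esub> = 0" using p[of "\<one>\<^bsub>G\<^esub>" "\<one>\<^bsub>G\<^esub>"] q[of "\<one>\<^bsub>G\<^esub>" "\<one>\<^bsub>G\<^esub>"] by auto
  have minv: "p (inv\<^bsub>G\<^esub> x) = - p x" "q (inv\<^bsub>G\<^esub> x) = - q x" if "x \<in> carrier G" for x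
    using p[of "inv\<^bsub>G\<^esub> x" x] q[of "inv\<^bsub>G\<^esub> x" x] that one by (simp_all add: l_inv)
  have ge1: "1 \<le> p (\<phi> x) + q (\<phi> x)"
    if "x \<in> carrier G" "0 \<le> p x" "0 \<le> q x" "\<not> (p x = 0 \<and> q x = 0)" for x
    using inv[of x] inv[of "inv\<^bsub>G\<^esub> x"] that minv[of x] minv[of "\<phi> x"] by auto
  have step: "p (\<phi> x) + q (\<phi> x) = p (\<phi> e) + q (\<phi> e) + (p (\<phi> (inv\<^bsub>G\<^esub> e \<otimes>\<^bsub>G\<^esub> x)) + q (\<phi> (inv\<^bsub>G\<^esub> e \<otimes>\<^bsub>G\<^esub> x)))"
    "p (inv\<^bsub>G\<^esub> e \<otimes>\<^bsub>G\<^esub> x) = p x - p e" "q (inv\<^bsub>G\<^esub> e \<otimes>\<^bsub>G\<^esub> x) = q x - q e"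
    if "x \<in> carrier G" "e \<in> carrier G" for x e
    using that by (simp_all add: p q minv)
  have "int n = p x + q x \<Longrightarrow> x \<in> carrier G \<Longrightarrow> 0 \<le> p x \<Longrightarrow> 0 \<le> q x \<Longrightarrow> int n \<le> p (\<phi> x) + q (\<phi> x)" for n x
  proof (induction n arbitrary: x)
    case 0
    then show ?case using inv[of x] by auto
  next
    case (Suc n)
    obtain e where e: "e \<in> carrier G" "p e + q e = 1" "0 \<le> p e" "0 \<le> q e" "p e \<le> p x" "q e \<le> q x"
    proof (cases "1 \<le> p x")
      case True then show ?thesis using a Suc.prems that[of a] by auto
    next
      case False then show ?thesis using b Suc.prems that[of b] by auto
    qed
    have "int n \<le> p (\<phi> (inv\<^bsub>G\<^esub> e \<otimes>\<^bsub>G\<^esub> x)) + q (\<phi> (inv\<^bsub>G\<^esub> e \<otimes>\<^bsub>G\<^esub> x))"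
      using Suc.prems e by (intro Suc.IH) (auto simp: step(2,3))
    moreover have "1 \<le> p (\<phi> e) + q (\<phi> e)" using e by (intro ge1) auto
    ultimately show ?case using step(1)[OF Suc.prems(2) e(1)] by simp
  qed
  from this[of "nat (p f + q f)" f] f show ?thesis by auto
qed

text \<open>
  On the quadrant, both \<open>\<phi>\<close> and its inverse do not decrease the weight \<open>p + q\<close>, so \<open>\<phi>\<close> preserves
  it. Any element enters the quadrant after multiplication by a high power of \<open>a b\<close>.
\<close>

lemma quadrant_weight_invariant:
  assumes G: "group G" and p: "\<And>x y. x \<in> carrier G \<Longrightarrow> y \<in> carrier G \<Longrightarrow> p (x \<otimes>\<^bsub>G\<^esub> y) = p x + (p y :: int)"
    and q: "\<And>x y. x \<in> carrier G \<Longrightarrow> y \<in> carrier G \<Longrightarrow> q (x \<otimes>\<^bsub>G\<^esub> y) = q x + (q y :: int)"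
    and a: "a \<in> carrier G" "p a = 1" "q a = 0" and b: "b \<in> carrier G" "p b = 0" "q b = 1"
    and \<phi>: "\<phi> \<in> iso G G"
    and inv: "\<And>x. x \<in> carrier G \<Longrightarrow> 0 \<le> p (\<phi> x) \<and> 0 \<le> q (\<phi> x) \<longleftrightarrow> 0 \<le> p x \<and> 0 \<le> q x"
    and f: "f \<in> carrier G"
  shows "p (\<phi> f) + q (\<phi> f) = p f + q f"
proof -
  interpret group_hom G G \<phi>
    using G \<phi> by (auto simp: group_hom_def group_hom_axioms_def iso_def)
  let ?\<psi> = "inv_into (carrier G) \<phi>"
  have \<psi>: "?\<psi> \<in> iso G G" using \<phi> by (rule group.iso_set_sym[OF G])
  have img: "\<phi> ` carrier G = carrier G" and inj: "inj_on \<phi> (carrier G)"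
    using \<phi> by (auto simp: iso_def bij_betw_def)
  have \<phi>\<psi>: "\<phi> (?\<psi> x) = x" "?\<psi> x \<in> carrier G" if "x \<in> carrier G" for x
    using that img by (auto intro: f_inv_into_f inv_into_into)
  have \<psi>\<phi>: "?\<psi> (\<phi> x) = x" if "x \<in> carrier G" for x
    using that inj by simp
  have eq: "p (\<phi> x) + q (\<phi> x) = p x + q x" if x: "x \<in> carrier G" "0 \<le> p x" "0 \<le> q x" for x
  proof (rule antisym)
    show "p x + q x \<le> p (\<phi> x) + q (\<phi> x)"
      using quadrant_weight_le[OF G p q a b homh inv x] by simp
    have "0 \<le> p (?\<psi> y) \<and> 0 \<le> q (?\<psi> y) \<longleftrightarrow> 0 \<le> p y \<and> 0 \<le> q y" if "y \<in> carrier G" for y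
      using inv[OF \<phi>\<psi>(2)[OF that]] \<phi>\<psi>(1)[OF that] by simp
    moreover have "?\<psi> \<in> hom G G" using \<psi> by (simp add: iso_def)
    moreover have "0 \<le> p (\<phi> x)" "0 \<le> q (\<phi> x)" using inv[OF x(1)] x by auto
    ultimately show "p (\<phi> x) + q (\<phi> x) \<le> p x + q x"
      using quadrant_weight_le[OF G p q a b, of ?\<psi> "\<phi> x"] x \<psi>\<phi> by simp
  qed
  have pow: "p (x [^]\<^bsub>G\<^esub> n) = int n * p x" "q (x [^]\<^bsub>G\<^esub> n) = int n * q x"
    if "x \<in> carrier G" for x and n :: nat
  proof (induction n)
    case 0
    case 1 show ?case using p[of "\<one>\<^bsub>G\<^esub>" "\<one>\<^bsub>G\<^esub>"] by simp
    case 2 show ?case using q[of "\<one>\<^bsub>G\<^esub>" "\<one>\<^bsub>G\<^esub>"] by simp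
  next
    case (Suc n)
    case 1 show ?case using Suc that by (simp add: p algebra_simps)
    case 2 show ?case using Suc that by (simp add: q algebra_simps)
  qed
  define m where "m = nat (max \<bar>p f\<bar> \<bar>q f\<bar>)"
  then have m: "0 \<le> p f + int m" "0 \<le> q f + int m" by linarith+
  let ?d = "(a \<otimes>\<^bsub>G\<^esub> b) [^]\<^bsub>G\<^esub> m"
  have d: "?d \<in> carrier G" "p ?d = int m" "q ?d = int m"
    using a b by (simp_all add: pow p q)
  have "p (\<phi> (f \<otimes>\<^bsub>G\<^esub> ?d)) + q (\<phi> (f \<otimes>\<^bsub>G\<^esub> ?d)) = p (f \<otimes>\<^bsub>G\<^esub> ?d) + q (f \<otimes>\<^bsub>G\<^esub> ?d)"
    using f d m by (intro eq) (auto simp: p q)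
  moreover have "p (\<phi> ?d) + q (\<phi> ?d) = p ?d + q ?d" using d by (intro eq) auto
  ultimately show ?thesis using f d(1) by (simp add: p q)
qed

section \<open>Twisted conjugacy classes\<close>

lemma reidemeister_number_infinite:
  fixes w :: "'a \<Rightarrow> int"
  assumes G: "group G" and \<phi>: "\<phi> \<in> hom G G"
    and w: "\<And>x y. x \<in> carrier G \<Longrightarrow> y \<in> carrier G \<Longrightarrow> w (x \<otimes>\<^bsub>G\<^esub> y) = w x + w y"
    and w\<phi>: "\<And>x. x \<in> carrier G \<Longrightarrow> w (\<phi> x) = w x"
    and inf: "infinite (w ` carrier G)"
  shows "reidemeister_number G \<phi> = \<infinity>"
proof -
  interpret group_hom G G \<phi>
    using G \<phi> by (auto simp: group_hom_def group_hom_axioms_def)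
  let ?R = "twisted_conj G \<phi>"
  have winv: "w (inv\<^bsub>G\<^esub> g) = - w g" if "g \<in> carrier G" for g
    using w[of "inv\<^bsub>G\<^esub> g" g] w[of "\<one>\<^bsub>G\<^esub>" "\<one>\<^bsub>G\<^esub>"] that by simp
  have const: "w y = w x" if "(x, y) \<in> ?R" for x y
    using that by (auto simp: twisted_conj_def w w\<phi> winv)
  have refl: "(x, x) \<in> ?R" if "x \<in> carrier G" for x
    using that unfolding twisted_conj_def by (auto intro!: bexI[of _ "\<one>\<^bsub>G\<^esub>"])
  have "w ` (?R `` {x}) = {w x}" if "x \<in> carrier G" for x
  proof
    show "w ` (?R `` {x}) \<subseteq> {w x}" by (auto dest: const)
    show "{w x} \<subseteq> w ` (?R `` {x})" using refl[OF that] by blast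
  qed
  moreover have "carrier G // ?R = (\<lambda>x. ?R `` {x}) ` carrier G"
    by (auto simp: quotient_def)
  ultimately have "(\<lambda>X. w ` X) ` (carrier G // ?R) = (\<lambda>i. {i}) ` (w ` carrier G)"
    by (simp add: image_image cong: image_cong)
  moreover have "infinite ((\<lambda>i. {i}) ` (w ` carrier G))"
    using inf by (simp add: finite_image_iff)
  ultimately have "infinite (carrier G // ?R)" by (metis finite_imageI)
  then show ?thesis unfolding reidemeister_number_def by simp
qed

theorem theorem3p5:
  fixes \<phi> :: "(real \<Rightarrow> real) \<Rightarrow> (real \<Rightarrow> real)"
  assumes "\<phi> \<in> iso thompson_F thompson_F"
  shows "reidemeister_number thompson_F \<phi> = \<infinity>"
  \<comment> \<open>The sign of \<open>shift_bot\<close> makes the preserved quadrant the one of nonnegative pairs.\<close>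
proof (rule reidemeister_number_infinite[OF group_thompson_F, where w = "\<lambda>f. - shift_bot f + shift_top f"])
  show "\<phi> \<in> hom thompson_F thompson_F" using assms by (simp add: iso_def)
  have closed: "\<phi> x \<in> thompson_F_carrier" if "x \<in> thompson_F_carrier" for x
    using assms that by (auto simp: iso_def hom_def thompson_F_carrier_eq)
  have s: "ramp (of_int 0) \<in> thompson_F_carrier" by (intro ramp_in_F dyadic_of_int)
  obtain r where r: "r \<in> thompson_F_carrier" "shift_bot r = 1" "shift_top r = 0"
    "\<forall>x \<ge> of_int 0. r x = x" using left_push_exists .
  show "- shift_bot (\<phi> f) + shift_top (\<phi> f) = - shift_bot f + shift_top f" if "f \<in> carrier thompson_F" for f
  proof (rule quadrant_weight_invariant[OF group_thompson_F _ _ _ _ _ _ _ _ assms _ that])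
    show "inv_into UNIV r \<in> carrier thompson_F" "ramp (of_int 0) \<in> carrier thompson_F"
      using r s by (simp_all add: thompson_F_carrier_eq thompson_F_inverse)
    show "- shift_bot (inv_into UNIV r) = 1" "shift_top (inv_into UNIV r) = 0"
      using r by (simp_all add: shift_inverse)
    show "- shift_bot (ramp (of_int 0)) = 0" "shift_top (ramp (of_int 0)) = 1"
      by (simp_all add: ramp_shift)
    show "0 \<le> - shift_bot (\<phi> x) \<and> 0 \<le> shift_top (\<phi> x) \<longleftrightarrow> 0 \<le> - shift_bot x \<and> 0 \<le> shift_top x"
      if "x \<in> carrier thompson_F" for x
      using displaces_commutators_iso[OF group_thompson_F assms that] that
        displaces_commutators_iff[of x] displaces_commutators_iff[OF closed[of x]]
      by (auto simp: thompson_F_carrier_eq)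
  qed (simp_all only: thompson_F_mult thompson_F_carrier_eq shift_compose)
  have "range int \<subseteq> (\<lambda>f. - shift_bot f + shift_top f) ` carrier thompson_F"
  proof
    fix i assume "i \<in> range int"
    then obtain n where "i = int n" by blast
    then have "i = - shift_bot (ramp (of_int 0) ^^ n) + shift_top (ramp (of_int 0) ^^ n)"
      by (simp only: shift_funpow[OF s] ramp_shift)
    then show "i \<in> (\<lambda>f. - shift_bot f + shift_top f) ` carrier thompson_F"
      using funpow_in_F[OF s, of n] by (auto simp: thompson_F_carrier_eq)
  qed
  moreover have "infinite (range int)" by (simp add: finite_image_iff)
  ultimately show "infinite ((\<lambda>f. - shift_bot f + shift_top f) ` carrier thompson_F)"
    using finite_subset by blast
qed (simp only: thompson_F_mult thompson_F_carrier_eq shift_compose)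

end
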